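(* If $X=(V,E)$ is a digraph with labeled vertices $v_1,v_2,\ldots,v_n$, then $$W_X=\sum_{\sigma\in\mathbb{S}_V(X,\overline{X})}(-1)^{\varphi(\sigma)}p_{\mathrm{Type}(\sigma)},$$ with $\varphi(\sigma)=\sum_{\gamma}(\ell(\gamma)-1)$, where the summation runs over all cycles $\gamma$ of $\sigma$ that are cycles in $X$ and $\ell(\gamma)$ denotes the length of the cycle $\gamma$.
   Context: A digraph is a pair $X=(V,E)$ with $V$ a finite set and $E\subseteq V\times V$ (loops are allowed). Its complementary digraph is $\overline{X}=(V,(V\times V)\setminus E)$. Write $\mathbb{P}$ for the set of positive integers. If $|V|=n$, a $V$-listing is a bijection $\sigma:[n]\to V$, written $\sigma=(\sigma_1,\ldots,\sigma_n)$. For a coloring $f:V\to\mathbb{P}$, a $V$-listing $\sigma$ is $(f,X)$-friendly if $f(\sigma_1)\le\cdots\le f(\sigma_n)$ and $f(\sigma_j)<f(\sigma_{j+1})$ for each $j\in[n-1]$ with $(\sigma_j,\sigma_{j+1})\in E$. Let $\Sigma_V(f,X)$ be the set of $(f,X)$-friendly $V$-listings. For a digraph $X$ with vertices labeled $v_1,\ldots,v_n$ in a fixed order, the Redei-Berge function in noncommuting variables is the formal power series in noncommuting variables $x_1,x_2,\ldots$ $$W_X=\sum_{f:V\to\mathbb{P}}\#\Sigma_V(f,X)\; x_{f(v_1)}x_{f(v_2)}\cdots x_{f(v_n)}.$$ $\mathbb{S}_V$ is the group of permutations of $V$. A cycle $(c_1,\ldots,c_k)$ of a permutation (sending $c_i\mapsto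 c_{i+1}$, indices mod $k$; fixed points are cycles of length 1) is a cycle of a digraph if all pairs $(c_i,c_{i+1})$ (indices mod $k$) are edges of that digraph; for $k=1$ this means that $(c_1,c_1)$ is an edge. $\mathbb{S}_V(X,\overline{X})$ is the set of $\sigma\in\mathbb{S}_V$ such that each cycle of $\sigma$ is a cycle of $X$ or a cycle of $\overline{X}$. Identifying $v_i$ with $i$, $\mathrm{Type}(\sigma)$ is the set partition of $[n]$ whose blocks are the underlying sets of the cycles of $\sigma$ (fixed points included). For a set partition $\pi$ of $[n]$, the noncommutative power sum is $p_\pi=\sum x_{i_1}x_{i_2}\cdots x_{i_n}$, summed over all sequences $(i_1,\ldots,i_n)$ of positive integers such that $i_j=i_k$ whenever $j$ and $k$ are in the same block of $\pi$. *)

theory Defs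
  imports
    "Graph_Theory.Pair_Digraph"
    "HOL-Combinatorics.Permutations"
    "HOL-Combinatorics.Multiset_Permutations"
    "HOL-Library.FuncSet"
begin

definition complement_digraph :: "'a pair_pre_digraph \<Rightarrow> 'a pair_pre_digraph" where
  "complement_digraph X =
     \<lparr> pverts = pverts X, parcs = (pverts X \<times> pverts X) - parcs X \<rparr>"


section \<open>Formal power series in noncommuting variables\<close>

text \<open>
  A word \<open>[i\<^sub>1, \<dots>, i\<^sub>n]\<close> stands for the monomial \<open>x\<^bsub>i\<^sub>1\<^esub> \<cdots> x\<^bsub>i\<^sub>n\<^esub>\<close>, and a series is the function
  giving the coefficient of each word. The variables are indexed by the positive integers, so
  words containing 0 always get coefficient 0 below.
\<close>

type_synonym nc_series = "nat list \<Rightarrow> int"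

text \<open>
  \<open>nc_sum I c m\<close> is the possibly infinite formal sum over \<open>i \<in> I\<close> of \<open>c i\<close> times the monomial
  \<open>m i\<close>. It is meaningful only if every word is \<open>m i\<close> for finitely many \<open>i \<in> I\<close>; in both uses
  below, \<open>m\<close> is injective on \<open>I\<close>.
\<close>

definition nc_sum :: "'i set \<Rightarrow> ('i \<Rightarrow> int) \<Rightarrow> ('i \<Rightarrow> nat list) \<Rightarrow> nc_series" where
  "nc_sum I c m = (\<lambda>w. \<Sum>i\<in>{i \<in> I. m i = w}. c i)"

text \<open>
  Set partitions are partitions of the positions \<open>{..<n}\<close> of a word: the usual \<open>[n]\<close> shifted
  by one, as list positions start from 0.
\<close>

definition nc_power_sum :: "nat \<Rightarrow> nat set set \<Rightarrow> nc_series" where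
  "nc_power_sum n \<pi> =
     nc_sum {w. length w = n \<and> set w \<subseteq> {1..} \<and> (\<forall>B\<in>\<pi>. \<forall>j\<in>B. \<forall>k\<in>B. w ! j = w ! k)}
       (\<lambda>_. 1) (\<lambda>w. w)"


section \<open>The Redei-Berge function\<close>

text \<open>Listings of the vertex set are elements of \<^const>\<open>permutations_of_set\<close>.\<close>

definition friendly_listings :: "('a \<Rightarrow> nat) \<Rightarrow> 'a pair_pre_digraph \<Rightarrow> 'a list set" where
  "friendly_listings f X =
     {s \<in> permutations_of_set (pverts X).
        sorted (map f s) \<and>
        (\<forall>j. Suc j < length s \<longrightarrow> (s ! j, s ! Suc j) \<in> parcs X \<longrightarrow> f (s ! j) < f (s ! Suc j))}"

text \<open>
  The list \<open>vs\<close> is the labelling of the vertices. Colorings are taken to be \<^const>\<open>undefined\<close>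
  outside the vertex set, so that each one is counted only once.
\<close>

definition redei_berge :: "'a pair_pre_digraph \<Rightarrow> 'a list \<Rightarrow> nc_series" where
  "redei_berge X vs =
     nc_sum (pverts X \<rightarrow>\<^sub>E {1..}) (\<lambda>f. int (card (friendly_listings f X))) (\<lambda>f. map f vs)"

lemma inj_on_coloring_word: "inj_on (\<lambda>f. map f vs) (set vs \<rightarrow>\<^sub>E A)"
  by (auto simp: inj_on_def intro: PiE_ext)


section \<open>Cycles of permutations and of digraphs\<close>

text \<open>
  The cycle \<open>(c\<^sub>1, \<dots>, c\<^sub>k)\<close> is represented by its set of pairs \<open>(c\<^sub>i, c\<^bsub>i+1\<^esub>)\<close>, indices mod \<open>k\<close>, which
  identifies two distinct-entry lists iff they differ by a rotation. For such a set \<open>\<gamma>\<close>, the length is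
  \<open>card \<gamma>\<close>, the underlying set is \<open>Domain \<gamma>\<close>, and being a cycle of a digraph \<open>X\<close> means
  \<open>\<gamma> \<subseteq> parcs X\<close>.
\<close>

definition cyclic_pairs :: "'a list \<Rightarrow> ('a \<times> 'a) set" where
  "cyclic_pairs c = {(c ! i, c ! (Suc i mod length c)) | i. i < length c}"

definition perm_cycles :: "'a set \<Rightarrow> ('a \<Rightarrow> 'a) \<Rightarrow> ('a \<times> 'a) set set" where
  "perm_cycles V \<sigma> =
     {cyclic_pairs c | c. c \<noteq> [] \<and> distinct c \<and> set c \<subseteq> V \<and>
        (\<forall>i < length c. \<sigma> (c ! i) = c ! (Suc i mod length c))}"

definition is_digraph_cycle :: "'a pair_pre_digraph \<Rightarrow> ('a \<times> 'a) set \<Rightarrow> bool" where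
  "is_digraph_cycle X \<gamma> \<longleftrightarrow> \<gamma> \<subseteq> parcs X"

definition compatible_perms :: "'a pair_pre_digraph \<Rightarrow> ('a \<Rightarrow> 'a) set" where
  "compatible_perms X =
     {\<sigma>. \<sigma> permutes pverts X \<and>
        (\<forall>\<gamma> \<in> perm_cycles (pverts X) \<sigma>.
           is_digraph_cycle X \<gamma> \<or> is_digraph_cycle (complement_digraph X) \<gamma>)}"

definition perm_phi :: "'a pair_pre_digraph \<Rightarrow> ('a \<Rightarrow> 'a) \<Rightarrow> nat" where
  "perm_phi X \<sigma> = (\<Sum>\<gamma> \<in> {\<gamma> \<in> perm_cycles (pverts X) \<sigma>. is_digraph_cycle X \<gamma>}. card \<gamma> - 1)"

text \<open>Vertices are identified with their positions in the labelling \<open>vs\<close>.\<close>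

definition perm_type :: "'a list \<Rightarrow> ('a \<Rightarrow> 'a) \<Rightarrow> nat set set" where
  "perm_type vs \<sigma> =
     (\<lambda>\<gamma>. {i. i < length vs \<and> vs ! i \<in> Domain \<gamma>}) ` perm_cycles (set vs) \<sigma>"

end

theory Submission
  imports Defs "HOL-Combinatorics.Cycles"
begin

text \<open>
  The coefficient of a word compares, for a fixed coloring \<open>f\<close>, friendly listings with the
  color-preserving compatible permutations. Both sides are expanded by inclusion-exclusion over
  the sets \<open>F\<close> of monochromatic arcs of \<open>X\<close>: listings in which all arcs of \<open>F\<close> join consecutive
  entries on one side, permutations whose graph contains \<open>F\<close>, with \<open>F\<close> acyclic, on the other.
  For each \<open>F\<close> the two counts agree, by contracting the arcs of \<open>F\<close> one at a time.
\<close>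

section \<open>Alternating sums over sets of arcs\<close>

text \<open>Inserting a fixed element reverses the sign, so the subsets with and without it
  cancel.\<close>

lemma sum_alternating_Pow:
  assumes "finite A"
  shows "(\<Sum>F\<in>Pow A. (-1) ^ card F) = (of_bool (A = {}) :: int)"
  using assms
proof (induction A rule: finite_induct)
  case (insert x A)
  have fin: "finite F" and nin: "x \<notin> F" if "F \<in> Pow A" for F
    using that insert.hyps by (auto dest: finite_subset)
  have "(\<Sum>F\<in>insert x ` Pow A. (-1) ^ card F) = (\<Sum>F\<in>Pow A. (-1::int) ^ card (insert x F))"
    using insert.hyps by (subst sum.reindex) (auto simp: inj_on_def)
  also have "\<dots> = - (\<Sum>F\<in>Pow A. (-1) ^ card F)"
    unfolding sum_negf[symmetric] by (intro sum.cong) (simp_all add: fin nin)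
  finally show ?case
    unfolding Pow_insert using insert.hyps
    by (subst sum.union_disjoint) auto
qed simp

text \<open>Expanding the product chooses one subset \<open>S\<close> of each block. As the blocks
  are disjoint, the choices correspond to their union \<open>F\<close>, and the signs multiply. The
  blocks will be the cycles of a permutation.\<close>

lemma prod_alternating_sum_disjoint:
  fixes C :: "'a set set"
  assumes "finite C" "\<And>\<gamma>. \<gamma> \<in> C \<Longrightarrow> finite \<gamma>" "pairwise disjnt C"
  shows "(\<Prod>\<gamma>\<in>C. \<Sum>S | S \<subseteq> \<gamma> \<inter> E \<and> \<not> \<gamma> \<subseteq> S. (-1) ^ card S) =
    (\<Sum>F | F \<subseteq> \<Union>C \<inter> E \<and> (\<forall>\<gamma>\<in>C. \<not> \<gamma> \<subseteq> F). (-1::int) ^ card F)"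
  using assms
proof (induction C rule: finite_induct)
  case empty
  have "{F. F \<subseteq> \<Union>{} \<inter> E \<and> (\<forall>\<gamma>\<in>{}. \<not> \<gamma> \<subseteq> F)} = {{}}"
    by auto
  then show ?case
    by (simp del: Union_empty)
next
  case (insert \<gamma> C)
  define P where "P = {S. S \<subseteq> \<gamma> \<inter> E \<and> \<not> \<gamma> \<subseteq> S}"
  define Q where "Q = {F. F \<subseteq> \<Union>C \<inter> E \<and> (\<forall>\<gamma>\<in>C. \<not> \<gamma> \<subseteq> F)}"
  define R where "R = {F. F \<subseteq> \<Union>(insert \<gamma> C) \<inter> E \<and> (\<forall>\<delta>\<in>insert \<gamma> C. \<not> \<delta> \<subseteq> F)}"
  have disj: "\<gamma> \<inter> \<Union>C = {}"
    using insert.prems(2) insert.hyps(2) by (auto simp: pairwise_insert disjnt_def)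
  have fin: "finite \<gamma>" "finite (\<Union>C)"
    using insert.hyps insert.prems by auto
  have PQ: "S \<subseteq> \<gamma>" "T \<subseteq> \<Union>C" "finite S" "finite T" "S \<inter> T = {}" if "S \<in> P" "T \<in> Q" for S T
  proof -
    show *: "S \<subseteq> \<gamma>" "T \<subseteq> \<Union>C"
      using that by (auto simp: P_def Q_def)
    show "finite S" "finite T" "S \<inter> T = {}"
      using * fin disj by (auto intro: finite_subset)
  qed
  have bij: "bij_betw (\<lambda>(S, T). S \<union> T) (P \<times> Q) R"
  proof (rule bij_betw_byWitness[where f' = "\<lambda>F. (F \<inter> \<gamma>, F \<inter> \<Union>C)"])
    show "\<forall>a\<in>P \<times> Q. (\<lambda>F. (F \<inter> \<gamma>, F \<inter> \<Union>C)) ((\<lambda>(S, T). S \<union> T) a) = a"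
      using PQ(1,2) disj by fast
    show "\<forall>F\<in>R. (\<lambda>(S, T). S \<union> T) (F \<inter> \<gamma>, F \<inter> \<Union>C) = F"
      unfolding R_def by auto
    show "(\<lambda>(S, T). S \<union> T) ` (P \<times> Q) \<subseteq> R"
    proof clarsimp
      fix S T assume ST: "S \<in> P" "T \<in> Q"
      have "\<not> \<gamma> \<subseteq> S \<union> T"
        using ST PQ(2)[OF ST] disj unfolding P_def by blast
      moreover have "\<not> \<delta> \<subseteq> S \<union> T" if "\<delta> \<in> C" for \<delta>
      proof -
        \<comment> \<open>A block of \<open>C\<close> misses \<open>\<gamma>\<close>, so only the
          part \<open>T\<close> could contain it.\<close>
        have "\<not> \<delta> \<subseteq> T" "\<delta> \<inter> \<gamma> = {}"
          using that ST disj unfolding Q_def by auto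
        then show ?thesis
          using PQ(1)[OF ST] by blast
      qed
      ultimately show "S \<union> T \<in> R"
        using ST unfolding P_def Q_def R_def by auto
    qed
    show "(\<lambda>F. (F \<inter> \<gamma>, F \<inter> \<Union>C)) ` R \<subseteq> P \<times> Q"
      unfolding P_def Q_def R_def by auto
  qed
  have "(\<Sum>S\<in>P. (-1) ^ card S) * (\<Sum>T\<in>Q. (-1) ^ card T) =
      (\<Sum>(S, T)\<in>P \<times> Q. (-1::int) ^ card S * (-1) ^ card T)"
    by (simp add: sum_product sum.cartesian_product)
  also have "\<dots> = (\<Sum>(S, T)\<in>P \<times> Q. (-1) ^ card (S \<union> T))"
    by (intro sum.cong) (auto simp: card_Un_disjoint PQ power_add)
  also have "\<dots> = (\<Sum>F\<in>R. (-1) ^ card F)"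
    using sum.reindex_bij_betw[OF bij, of "\<lambda>F. (-1::int) ^ card F"] by (simp add: case_prod_unfold)
  finally show ?case
    using insert.IH insert.prems insert.hyps
    unfolding P_def Q_def R_def by (simp add: pairwise_insert)
qed

text \<open>If \<open>\<gamma> \<subseteq> E\<close>, only the term of \<open>\<gamma>\<close>
  itself is missing from a vanishing sum over the power set, which leaves the negative of that term:
  this is the sign attached to a cycle of the digraph. Otherwise no subset of
  \<open>\<gamma> \<inter> E\<close> contains \<open>\<gamma>\<close>, and the power set is
  complete.\<close>

lemma alternating_sum_proper_subsets:
  assumes "finite \<gamma>" "\<gamma> \<noteq> {}"
  shows "(\<Sum>S | S \<subseteq> \<gamma> \<inter> E \<and> \<not> \<gamma> \<subseteq> S. (-1) ^ card S) =
    (if \<gamma> \<subseteq> E then (-1) ^ (card \<gamma> - 1) else of_bool (\<gamma> \<inter> E = {}) :: int)"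
proof (cases "\<gamma> \<subseteq> E")
  case True
  then have eq: "{S. S \<subseteq> \<gamma> \<inter> E \<and> \<not> \<gamma> \<subseteq> S} = Pow \<gamma> - {\<gamma>}"
    by auto
  have pos: "card \<gamma> > 0"
    using assms by (simp add: card_gt_0_iff)
  show ?thesis
    unfolding eq using assms True pos
    by (simp add: sum_diff1 sum_alternating_Pow) (cases "card \<gamma>"; simp)
next
  case False
  then have eq: "{S. S \<subseteq> \<gamma> \<inter> E \<and> \<not> \<gamma> \<subseteq> S} = Pow (\<gamma> \<inter> E)"
    by auto
  show ?thesis
    unfolding eq using assms False by (subst sum_alternating_Pow) auto
qed


section \<open>Linear sets of arcs\<close>

definition consecutive_pairs :: "'a list \<Rightarrow> ('a \<times> 'a) set" where
  "consecutive_pairs s = {(s ! j, s ! Suc j) | j. Suc j < length s}"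

text \<open>For finite \<open>F\<close> these are the disjoint unions of directed paths; acyclicity
  also excludes loops.\<close>

definition linear_arcs :: "('a \<times> 'a) set \<Rightarrow> bool" where
  "linear_arcs F \<longleftrightarrow> single_valued F \<and> single_valued (F\<inverse>) \<and> acyclic F"

lemma linear_arcs_mono: "linear_arcs F \<Longrightarrow> G \<subseteq> F \<Longrightarrow> linear_arcs G"
  unfolding linear_arcs_def
  by (meson acyclic_subset converse_mono single_valued_subset)

lemma consecutive_pairs_Nil [simp]: "consecutive_pairs [] = {}"
  and consecutive_pairs_singleton [simp]: "consecutive_pairs [x] = {}"
  by (auto simp: consecutive_pairs_def)

lemma consecutive_pairs_Cons_Cons [simp]:
  "consecutive_pairs (x # y # s) = insert (x, y) (consecutive_pairs (y # s))"
proof -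
  have "(\<exists>j. p = ((x # y # s) ! j, (y # s) ! j) \<and> j < Suc (length s)) \<longleftrightarrow>
    p = (x, y) \<or> (\<exists>j. p = ((y # s) ! j, s ! j) \<and> j < length s)" (is "(\<exists>j. ?P j) \<longleftrightarrow> _") for p
  proof -
    have "(\<exists>j. ?P j) \<longleftrightarrow> ?P 0 \<or> (\<exists>j. ?P (Suc j))"
      by (metis not0_implies_Suc)
    then show ?thesis
      by auto
  qed
  then show ?thesis
    unfolding consecutive_pairs_def by auto
qed

text \<open>The entry \<open>y\<close> belongs to both pieces, so that no pair is lost at the
  cut.\<close>

lemma consecutive_pairs_append:
  "consecutive_pairs (xs @ y # ys) =
    consecutive_pairs (xs @ [y]) \<union> consecutive_pairs (y # ys)"
  by (induction xs rule: induct_list012) auto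

text \<open>Positions strictly increase along a path of consecutive pairs, and in a distinct list an
  entry determines its position.\<close>

lemma linear_consecutive_pairs:
  assumes "distinct s"
  shows "linear_arcs (consecutive_pairs s)"
proof -
  have trancl: "\<exists>i j. x = s ! i \<and> y = s ! j \<and> i < j \<and> j < length s"
    if "(x, y) \<in> (consecutive_pairs s)\<^sup>+" for x y
    using that
  proof induction
    case (base y)
    then show ?case
      by (auto simp: consecutive_pairs_def)
  next
    case (step y z)
    then obtain i j k where *: "x = s ! i" "y = s ! j" "i < j" "j < length s"
      "y = s ! k" "z = s ! Suc k" "Suc k < length s"
      by (auto simp: consecutive_pairs_def)
    then have "j = k"
      using assms by (simp add: nth_eq_iff_index_eq)
    with * show ?case
      by (intro exI[of _ i] exI[of _ "Suc k"]) auto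
  qed
  have "acyclic (consecutive_pairs s)"
    using assms by (auto simp: acyclic_def nth_eq_iff_index_eq dest!: trancl)
  then show ?thesis
    using assms
    by (auto simp: linear_arcs_def single_valued_def consecutive_pairs_def nth_eq_iff_index_eq)
qed

text \<open>A finite acyclic relation is well-founded. A minimal element \<open>u\<close> of the
  domain has no predecessor, since any predecessor would lie in the domain too.\<close>

lemma linear_arcs_start:
  assumes "linear_arcs F" "finite F" "F \<noteq> {}"
  obtains u v where "(u, v) \<in> F" "u \<notin> Range F" "u \<noteq> v"
proof -
  have acyc: "acyclic F"
    using assms(1) by (simp add: linear_arcs_def)
  then have "wf F"
    using assms(2) finite_acyclic_wf by blast
  moreover obtain z where "z \<in> Domain F"
    using assms(3) by auto
  ultimately obtain u where u: "u \<in> Domain F" "\<And>y. (y, u) \<in> F \<Longrightarrow> y \<notin> Domain F"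
    by (rule wfE_min) blast
  then obtain v where "(u, v) \<in> F"
    by auto
  moreover have "u \<notin> Range F"
    using u(2) by blast
  moreover from calculation have "u \<noteq> v"
    by auto
  ultimately show ?thesis
    using that by blast
qed


section \<open>Extending a linear set of arcs\<close>

definition sorted_listings :: "('a \<Rightarrow> 'b::linorder) \<Rightarrow> 'a set \<Rightarrow> 'a list set" where
  "sorted_listings f V = {s \<in> permutations_of_set V. sorted (map f s)}"

text \<open>These permutations form the product of the symmetric groups of the color
  classes.\<close>

definition color_perms :: "('a \<Rightarrow> 'b) \<Rightarrow> 'a set \<Rightarrow> ('a \<Rightarrow> 'a) set" where
  "color_perms f V = {\<sigma>. \<sigma> permutes V \<and> (\<forall>x\<in>V. f (\<sigma> x) = f x)}"

lemma finite_sorted_listings [simp]: "finite (sorted_listings f V)"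
  by (simp add: sorted_listings_def)

lemma finite_color_perms: "finite V \<Longrightarrow> finite (color_perms f V)"
  by (simp add: color_perms_def finite_permutations)

lemma sorted_listings_iff: "s \<in> sorted_listings f V \<longleftrightarrow> set s = V \<and> distinct s \<and> sorted (map f s)"
  by (auto simp: sorted_listings_def permutations_of_set_def)

text \<open>The color-preserving permutations act simply transitively on the sorted listings, so
  applying them to one such listing \<open>s\<close> gives a bijection. This is the case of no
  prescribed arcs.\<close>

lemma card_sorted_listings:
  assumes "finite V"
  shows "card (sorted_listings f V) = card (color_perms f V)"
proof -
  obtain t where t: "set t = V" "distinct t"
    using assms finite_distinct_list by blast
  define s where "s = sort_key f t"
  have s: "set s = V" "distinct s" "sorted (map f s)"
    using t by (auto simp: s_def)
  have "bij_betw (\<lambda>\<sigma>. map \<sigma> s) (color_perms f V) (sorted_listings f V)"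
    unfolding bij_betw_def
  proof (intro conjI inj_onI subset_antisym subsetI)
    fix \<sigma> \<tau> assume st: "\<sigma> \<in> color_perms f V" "\<tau> \<in> color_perms f V" "map \<sigma> s = map \<tau> s"
    show "\<sigma> = \<tau>"
    proof
      fix x show "\<sigma> x = \<tau> x"
        using st s(1) by (cases "x \<in> V") (auto simp: color_perms_def permutes_not_in)
    qed
  next
    fix r assume "r \<in> (\<lambda>\<sigma>. map \<sigma> s) ` color_perms f V"
    then obtain \<sigma> where \<sigma>: "r = map \<sigma> s" "\<sigma> \<in> color_perms f V"
      by auto
    then have p: "\<sigma> permutes V"
      by (simp add: color_perms_def)
    have "map f r = map f s"
      using \<sigma> s(1) by (auto simp: color_perms_def)
    moreover have "set r = V" "distinct r"
      using \<sigma>(1) s p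
      by (auto simp: permutes_image distinct_map intro: inj_on_subset[OF permutes_inj])
    ultimately show "r \<in> sorted_listings f V"
      using s(3) by (simp add: sorted_listings_iff)
  next
    fix r assume "r \<in> sorted_listings f V"
    then have r: "set r = V" "distinct r" "sorted (map f r)"
      by (auto simp: sorted_listings_iff)
    have len: "length r = length s"
      using r s by (metis distinct_card)
    \<comment> \<open>The only candidate: the entries of \<open>s\<close> go to the entries of
      \<open>r\<close> at the same positions, and everything outside \<open>V\<close> is
      fixed.\<close>
    define \<sigma> where "\<sigma> = (\<lambda>x. if x \<in> V then the (map_of (zip s r) x) else x)"
    have nth: "\<sigma> (s ! i) = r ! i" if "i < length s" for i
      using that s len by (auto simp: \<sigma>_def map_of_zip_nth)
    have map: "map \<sigma> s = r"
      using nth len by (auto intro: nth_equalityI)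
    have "bij_betw \<sigma> V V"
      unfolding bij_betw_def
    proof
      show "\<sigma> ` V = V"
        using map r(1) s(1) by (metis set_map)
      show "inj_on \<sigma> V"
        using map r(2) s(1) by (metis distinct_map)
    qed
    then have "\<sigma> permutes V"
      by (rule bij_imp_permutes) (simp add: \<sigma>_def)
    moreover have "map f r = map f s"
    proof -
      \<comment> \<open>Both color words are sorted, so it suffices that they have the same multiset
        of colors.\<close>
      have "mset (map f r) = mset (map f s)"
        using r(1,2) s(1,2) set_eq_iff_mset_eq_distinct by (metis mset_map)
      then show ?thesis
        using r(3) s(3) by (metis properties_for_sort)
    qed
    ultimately have "\<sigma> \<in> color_perms f V"
      using map s(1) by (force simp: color_perms_def)
    then show "r \<in> (\<lambda>\<sigma>. map \<sigma> s) ` color_perms f V"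
      using map by auto
  qed
  then show ?thesis
    by (metis bij_betw_same_card)
qed

text \<open>
  An arc \<open>(u, v)\<close> at the start of a path can be contracted: remove the entry \<open>u\<close> in front of \<open>v\<close>
  from a listing, and compose a permutation with the transposition of \<open>u\<close> and \<open>v\<close>.
\<close>

lemma card_listings_contract:
  assumes F: "linear_arcs F" "F \<subseteq> V \<times> V" and uv: "(u, v) \<in> F" "u \<notin> Range F" "f u = f v"
  shows "card {s \<in> sorted_listings f V. F \<subseteq> consecutive_pairs s} =
    card {s \<in> sorted_listings f (V - {u}). F - {(u, v)} \<subseteq> consecutive_pairs s}"
    (is "card ?A = card ?B")
proof -
  have neq: "u \<noteq> v"
    using uv by auto
  have inV: "u \<in> V" "v \<in> V"
    using uv F(2) by auto
  have snd_F: "(x, v) \<in> F \<Longrightarrow> x = u" for x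
    using F(1) uv(1) by (auto simp: linear_arcs_def single_valued_def)
  \<comment> \<open>Both directions of the bijection rest on this equivalence.\<close>
  have char: "xs @ u # v # ys \<in> ?A \<longleftrightarrow> xs @ v # ys \<in> ?B" for xs ys
  proof (cases "distinct (xs @ u # v # ys)")
    case True
    \<comment> \<open>The two prefixes differ only in the pair that ends in the last entry. This
      pair does not matter: \<open>F\<close> has no arc into \<open>u\<close>, and none into
      \<open>v\<close> except \<open>(u, v)\<close>.\<close>
    have "consecutive_pairs (xs @ [v]) - UNIV \<times> {v} = consecutive_pairs (xs @ [u]) - UNIV \<times> {u}"
      using True
    proof (induction xs rule: induct_list012)
      case (3 x y zs)
      then show ?case by auto
    qed auto
    then have "F \<subseteq> consecutive_pairs (xs @ u # v # ys) \<longleftrightarrow>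
      F - {(u, v)} \<subseteq> consecutive_pairs (xs @ v # ys)"
      using uv(2) snd_F True
        consecutive_pairs_append[of xs u "v # ys"] consecutive_pairs_append[of xs v ys]
      by auto
    then show ?thesis
      using True inV uv(3) by (auto simp: sorted_listings_iff sorted_append)
  next
    case False
    then show ?thesis
      using inV by (auto simp: sorted_listings_iff)
  qed
  have "bij_betw (remove1 u) ?A ?B"
    unfolding bij_betw_def
  proof (intro conjI inj_onI subset_antisym subsetI)
    \<comment> \<open>As \<open>(u, v)\<close> is in \<open>F\<close>, the entry \<open>u\<close>
      stands immediately before \<open>v\<close>. Since \<open>v\<close> occurs only once, cutting
      the shortened list at \<open>v\<close> recovers \<open>xs\<close> and \<open>ys\<close>, which
      gives injectivity.\<close>
    have split: "\<exists>xs ys. s = xs @ u # v # ys \<and> remove1 u s = xs @ v # ys \<and>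
      v \<notin> set xs \<and> v \<notin> set ys" if "s \<in> ?A" for s
    proof -
      have s: "distinct s" "(u, v) \<in> consecutive_pairs s"
        using that uv(1) by (auto simp: sorted_listings_iff)
      then obtain j where j: "Suc j < length s" "u = s ! j" "v = s ! Suc j"
        by (auto simp: consecutive_pairs_def)
      then have "s = take j s @ u # v # drop (Suc (Suc j)) s"
        by (metis Cons_nth_drop_Suc Suc_lessD append_take_drop_id)
      then obtain xs ys where "s = xs @ u # v # ys"
        by blast
      with s(1) show ?thesis
        by (intro exI[of _ xs] exI[of _ ys]) (auto simp: remove1_append)
    qed
    show "s = t" if "s \<in> ?A" "t \<in> ?A" "remove1 u s = remove1 u t" for s t
      using split[OF that(1)] split[OF that(2)] that(3) by (auto simp: append_Cons_eq_iff)
    show "r \<in> ?B" if "r \<in> remove1 u ` ?A" for r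
      using that split char by fastforce
    show "r \<in> remove1 u ` ?A" if r: "r \<in> ?B" for r
    proof -
      have "v \<in> set r"
        using r inV neq by (auto simp: sorted_listings_iff)
      then obtain xs ys where xs: "r = xs @ v # ys"
        by (auto simp: in_set_conv_decomp)
      moreover have "u \<notin> set xs"
        using r xs by (auto simp: sorted_listings_iff)
      ultimately show ?thesis
        using r char by (intro image_eqI[of _ _ "xs @ u # v # ys"]) (auto simp: remove1_append)
    qed
  qed
  then show ?thesis
    by (rule bij_betw_same_card)
qed

lemma card_color_perms_contract:
  assumes F: "linear_arcs F" "F \<subseteq> V \<times> V" and uv: "(u, v) \<in> F" "u \<notin> Range F" "f u = f v"
  shows "card {\<sigma> \<in> color_perms f V. \<forall>(x, y)\<in>F. \<sigma> x = y} =
    card {\<sigma> \<in> color_perms f (V - {u}). \<forall>(x, y)\<in>F - {(u, v)}. \<sigma> x = y}"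
    (is "card ?A = card ?B")
proof -
  let ?t = "\<lambda>\<sigma>. transpose u v \<circ> \<sigma>"
  have neq: "u \<noteq> v"
    using uv by auto
  have inV: "u \<in> V" "v \<in> V"
    using uv F(2) by auto
  have snd_F: "(x, v) \<in> F \<Longrightarrow> x = u" for x
    using F(1) uv(1) by (auto simp: linear_arcs_def single_valued_def)
  \<comment> \<open>The transposition therefore does not disturb the remaining prescribed
    values.\<close>
  have other: "y \<noteq> u" "y \<noteq> v" if "(x, y) \<in> F" "(x, y) \<noteq> (u, v)" for x y
    using that uv(2) snd_F by blast+
  have f_t: "f (transpose u v x) = f x" for x
    using uv(3) by (auto simp: transpose_def)
  have "bij_betw ?t ?A ?B"
  \<comment> \<open>Composing with a transposition is an involution. It exchanges the conditions
    that \<open>\<sigma>\<close> sends \<open>u\<close> to \<open>v\<close> and that it fixes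
    \<open>u\<close>.\<close>
  proof (rule bij_betw_byWitness[where f' = ?t])
    show "?t ` ?A \<subseteq> ?B"
    proof clarify
      fix \<sigma> assume \<sigma>: "\<sigma> \<in> color_perms f V" "\<forall>(x, y)\<in>F. \<sigma> x = y"
      have "?t \<sigma> permutes V"
        using \<sigma>(1) inV by (auto simp: color_perms_def intro: permutes_compose permutes_swap_id)
      moreover have "?t \<sigma> u = u"
        using \<sigma>(2) uv(1) by auto
      ultimately have "?t \<sigma> permutes (V - {u})"
        by (auto simp: permutes_def)
      moreover have "f (?t \<sigma> x) = f x" if "x \<in> V" for x
        using \<sigma>(1) that by (simp add: f_t color_perms_def)
      moreover have "?t \<sigma> x = y" if "(x, y) \<in> F - {(u, v)}" for x y
        using \<sigma>(2) that other[of x y] by auto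
      ultimately show "?t \<sigma> \<in> color_perms f (V - {u}) \<and> (\<forall>(x, y)\<in>F - {(u, v)}. ?t \<sigma> x = y)"
        by (auto simp: color_perms_def)
    qed
    show "?t ` ?B \<subseteq> ?A"
    proof clarify
      fix \<sigma> assume \<sigma>: "\<sigma> \<in> color_perms f (V - {u})" "\<forall>(x, y)\<in>F - {(u, v)}. \<sigma> x = y"
      then have p: "\<sigma> permutes V" "\<sigma> u = u"
        by (auto simp: color_perms_def permutes_not_in intro: permutes_subset)
      have "?t \<sigma> permutes V"
        using p(1) inV by (auto intro: permutes_compose permutes_swap_id)
      moreover have "f (?t \<sigma> x) = f x" if "x \<in> V" for x
        using \<sigma>(1) p(2) that by (cases "x = u") (simp_all add: f_t color_perms_def uv(3))
      moreover have "?t \<sigma> x = y" if "(x, y) \<in> F" for x y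
      proof (cases "(x, y) = (u, v)")
        case False
        then have "\<sigma> x = y"
          using bspec[OF \<sigma>(2), of "(x, y)"] that False by simp
        then show ?thesis
          using other[OF that False] by simp
      qed (use p(2) in simp)
      ultimately show "?t \<sigma> \<in> color_perms f V \<and> (\<forall>(x, y)\<in>F. ?t \<sigma> x = y)"
        by (auto simp: color_perms_def)
    qed
  qed (auto simp: fun_eq_iff)
  then show ?thesis
    by (rule bij_betw_same_card)
qed

text \<open>Induction on the number of arcs; \<open>V\<close> varies because each contraction
  deletes a vertex.\<close>

lemma card_listings_eq_card_perms:
  assumes "finite V" "linear_arcs F" "F \<subseteq> V \<times> V" "\<And>x y. (x, y) \<in> F \<Longrightarrow> f x = f y"
  shows "card {s \<in> sorted_listings f V. F \<subseteq> consecutive_pairs s} =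
    card {\<sigma> \<in> color_perms f V. \<forall>(x, y)\<in>F. \<sigma> x = y}"
  using assms
proof (induction "card F" arbitrary: F V)
  case 0
  then have "F = {}"
    using finite_subset[of F "V \<times> V"] by auto
  then show ?case
    using card_sorted_listings[OF \<open>finite V\<close>] by simp
next
  case (Suc n)
  have "finite F" "F \<noteq> {}"
    using Suc.hyps(2) by (auto intro: card_ge_0_finite)
  then obtain u v where uv: "(u, v) \<in> F" "u \<notin> Range F" "u \<noteq> v"
    using linear_arcs_start Suc.prems(2) by blast
  have fst_F: "(u, x) \<in> F \<Longrightarrow> x = v" for x
    using Suc.prems(2) uv(1) by (auto simp: linear_arcs_def single_valued_def)
  have "card {s \<in> sorted_listings f (V - {u}). F - {(u, v)} \<subseteq> consecutive_pairs s} =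
    card {\<sigma> \<in> color_perms f (V - {u}). \<forall>(x, y)\<in>F - {(u, v)}. \<sigma> x = y}"
  proof (rule Suc.hyps(1))
    show "n = card (F - {(u, v)})"
      using Suc.hyps(2) uv(1) \<open>finite F\<close> by simp
    \<comment> \<open>No arc enters \<open>u\<close>, and \<open>(u, v)\<close> is the only one that
      leaves it.\<close>
    show "F - {(u, v)} \<subseteq> (V - {u}) \<times> (V - {u})"
      using Suc.prems(3) uv(2) fst_F by blast
    show "linear_arcs (F - {(u, v)})"
      using Suc.prems(2) by (rule linear_arcs_mono) auto
  qed (use Suc.prems in auto)
  then show ?case
    by (simp only: card_listings_contract[OF Suc.prems(2,3) uv(1,2) Suc.prems(4)[OF uv(1)]]
      card_color_perms_contract[OF Suc.prems(2,3) uv(1,2) Suc.prems(4)[OF uv(1)]])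
qed


section \<open>Cycles of a permutation\<close>

text \<open>The arcs of the cycle through \<open>x\<close>. Letting \<open>n\<close> run over all
  naturals avoids naming the period.\<close>

definition orbit_pairs :: "('a \<Rightarrow> 'a) \<Rightarrow> 'a \<Rightarrow> ('a \<times> 'a) set" where
  "orbit_pairs \<sigma> x = {((\<sigma> ^^ n) x, (\<sigma> ^^ Suc n) x) | n. True}"

lemma cyclic_pairs_eq_orbit_pairs:
  assumes "x \<in> set c" "\<forall>i < length c. \<sigma> (c ! i) = c ! (Suc i mod length c)"
  shows "cyclic_pairs c = orbit_pairs \<sigma> x"
proof -
  obtain i where i: "i < length c" "x = c ! i"
    using assms(1) by (auto simp: in_set_conv_nth)
  let ?k = "length c"
  have k: "?k > 0"
    using i by auto
  have pow: "(\<sigma> ^^ n) x = c ! ((i + n) mod ?k)" for n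
  proof (induction n)
    case (Suc n)
    then show ?case
      using assms(2) k by (simp add: mod_Suc_eq)
  qed (use i in simp)
  have pow': "(\<sigma> ^^ Suc n) x = c ! (Suc ((i + n) mod ?k) mod ?k)" for n
    by (subst pow) (simp add: mod_Suc_eq)
  show ?thesis
  proof (intro subset_antisym subsetI)
    fix p assume "p \<in> cyclic_pairs c"
    then obtain j where j: "j < ?k" "p = (c ! j, c ! (Suc j mod ?k))"
      by (auto simp: cyclic_pairs_def)
    \<comment> \<open>The number of steps from position \<open>i\<close> to position
      \<open>j\<close>; adding \<open>?k\<close> keeps the subtraction from truncating.\<close>
    have "(i + (j + ?k - i)) mod ?k = j"
      using i(1) j(1) by simp
    then show "p \<in> orbit_pairs \<sigma> x"
      unfolding orbit_pairs_def j(2) using pow[of "j + ?k - i"] pow'[of "j + ?k - i"]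
      by (intro CollectI exI[of _ "j + ?k - i"]) (simp del: funpow.simps)
  next
    fix p assume "p \<in> orbit_pairs \<sigma> x"
    then obtain n where "p = ((\<sigma> ^^ n) x, (\<sigma> ^^ Suc n) x)"
      by (auto simp: orbit_pairs_def)
    then show "p \<in> cyclic_pairs c"
      unfolding cyclic_pairs_def pow pow' using k
      by (intro CollectI exI[of _ "(i + n) mod ?k"]) (simp add: mod_Suc_eq)
  qed
qed

text \<open>Replaces lists up to rotation by orbits of points, the form in which cycles are handled
  from here on.\<close>

lemma perm_cycles_eq:
  assumes "finite V" "\<sigma> permutes V"
  shows "perm_cycles V \<sigma> = orbit_pairs \<sigma> ` V"
proof (intro subset_antisym subsetI)
  fix \<gamma> assume "\<gamma> \<in> perm_cycles V \<sigma>"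
  then obtain c where c: "\<gamma> = cyclic_pairs c" "c \<noteq> []" "set c \<subseteq> V"
    "\<forall>i < length c. \<sigma> (c ! i) = c ! (Suc i mod length c)"
    by (auto simp: perm_cycles_def)
  have "hd c \<in> set c"
    using c by simp
  then show "\<gamma> \<in> orbit_pairs \<sigma> ` V"
    using cyclic_pairs_eq_orbit_pairs[OF _ c(4)] c(1,3) by auto
next
  fix \<gamma> assume "\<gamma> \<in> orbit_pairs \<sigma> ` V"
  then obtain x where x: "x \<in> V" "\<gamma> = orbit_pairs \<sigma> x"
    by auto
  have perm: "permutation \<sigma>"
    using assms permutation_permutes by blast
  define k where "k = least_power \<sigma> x"
  have k: "(\<sigma> ^^ k) x = x" "k > 0"
    using least_power_of_permutation[OF perm] by (auto simp: k_def)
  \<comment> \<open>The iterates of \<open>x\<close> up to its least period \<open>k\<close>, listed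
    once each.\<close>
  let ?c = "support \<sigma> x"
  have len: "length ?c = k"
    by (simp add: k_def)
  have "\<sigma> (?c ! i) = ?c ! (Suc i mod length ?c)" if "i < length ?c" for i
  \<comment> \<open>At the last position the index wraps around to 0, matching the return of the
    iterates to \<open>x\<close>.\<close>
  proof (cases "Suc i = k")
    case True
    then have "(\<sigma> ^^ Suc i) x = x"
      using k by simp
    then have "?c ! (Suc i mod length ?c) = \<sigma> ((\<sigma> ^^ i) x)"
      using True k unfolding len by (simp add: k_def[symmetric] flip: funpow.simps(2)[THEN fun_cong, unfolded o_apply])
    then show ?thesis
      using that by simp
  next
    case False
    then show ?thesis
      using that unfolding len by (simp add: k_def)
  qed
  moreover have "distinct ?c"
    using cycle_of_permutation[OF perm] .
  moreover have "x \<in> set ?c"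
    using k by (force simp: k_def)
  moreover have "set ?c \<subseteq> V"
    using x(1) permutes_in_image[OF permutes_funpow[OF assms(2)]] by auto
  ultimately show "\<gamma> \<in> perm_cycles V \<sigma>"
    unfolding perm_cycles_def x(2)
    by (intro CollectI exI[of _ ?c]) (auto simp: cyclic_pairs_eq_orbit_pairs[symmetric])
qed

text \<open>A permutation of a finite set has finite order, so \<open>x\<close> is in turn an
  iterate of \<open>y\<close>.\<close>

lemma orbit_pairs_eq:
  assumes "finite V" "\<sigma> permutes V" "(y, z) \<in> orbit_pairs \<sigma> x"
  shows "orbit_pairs \<sigma> y = orbit_pairs \<sigma> x"
proof -
  have perm: "permutation \<sigma>"
    using assms permutation_permutes by blast
  obtain n where n: "y = (\<sigma> ^^ n) x"
    using assms(3) by (auto simp: orbit_pairs_def)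
  obtain k where k: "\<sigma> ^^ k = id" "k > 0"
    using permutation_is_nilpotent[OF perm] by auto
  show ?thesis
  proof (intro subset_antisym subsetI)
    fix p assume "p \<in> orbit_pairs \<sigma> y"
    then obtain m where "p = ((\<sigma> ^^ m) y, (\<sigma> ^^ Suc m) y)"
      by (auto simp: orbit_pairs_def)
    then have "p = ((\<sigma> ^^ (m + n)) x, (\<sigma> ^^ Suc (m + n)) x)"
      by (simp add: n funpow_add)
    then show "p \<in> orbit_pairs \<sigma> x"
      unfolding orbit_pairs_def by blast
  next
    fix p assume "p \<in> orbit_pairs \<sigma> x"
    then obtain m where m: "p = ((\<sigma> ^^ m) x, (\<sigma> ^^ Suc m) x)"
      by (auto simp: orbit_pairs_def)
    have "\<sigma> ^^ (k * n) = id"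
      by (metis funpow_mult id_funpow k(1))
    \<comment> \<open>Since \<open>k\<close> is positive, \<open>k * n\<close> is at least
      \<open>n\<close>, and the remaining \<open>l\<close> steps lead from \<open>y\<close> back to
      \<open>x\<close>.\<close>
    moreover obtain l where "k * n = l + n"
      using k(2) by (metis add.commute le_add_diff_inverse mult_le_mono1 nat_mult_1 Suc_leI One_nat_def)
    ultimately have "(\<sigma> ^^ l) y = x"
      by (metis comp_apply funpow_add id_apply n)
    then have "p = ((\<sigma> ^^ (m + l)) y, (\<sigma> ^^ Suc (m + l)) y)"
      by (simp add: m funpow_add)
    then show "p \<in> orbit_pairs \<sigma> y"
      unfolding orbit_pairs_def by blast
  qed
qed

text \<open>Cycles that share an arc are both the orbit of its source.\<close>

lemma pairwise_disjnt_perm_cycles: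
  assumes "finite V" "\<sigma> permutes V"
  shows "pairwise disjnt (perm_cycles V \<sigma>)"
  unfolding perm_cycles_eq[OF assms] pairwise_image
  unfolding pairwise_def disjnt_def
  by (metis assms disjoint_iff orbit_pairs_eq surj_pair)

lemma Union_perm_cycles:
  assumes "finite V" "\<sigma> permutes V"
  shows "\<Union>(perm_cycles V \<sigma>) = {(x, \<sigma> x) | x. x \<in> V}"
proof (intro subset_antisym subsetI)
  fix p assume "p \<in> \<Union>(perm_cycles V \<sigma>)"
  then show "p \<in> {(x, \<sigma> x) | x. x \<in> V}"
    using permutes_in_image[OF permutes_funpow[OF assms(2)]]
    by (auto simp: perm_cycles_eq[OF assms] orbit_pairs_def)
next
  fix p assume "p \<in> {(x, \<sigma> x) | x. x \<in> V}"
  then obtain x where "x \<in> V" "p = ((\<sigma> ^^ 0) x, (\<sigma> ^^ Suc 0) x)"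
    by auto
  then show "p \<in> \<Union>(perm_cycles V \<sigma>)"
    unfolding perm_cycles_eq[OF assms] orbit_pairs_def by blast
qed

lemma perm_cycles_finite:
  assumes "finite V" "\<sigma> permutes V"
  shows "finite (perm_cycles V \<sigma>)"
    and "\<gamma> \<in> perm_cycles V \<sigma> \<Longrightarrow> finite \<gamma>"
    and "\<gamma> \<in> perm_cycles V \<sigma> \<Longrightarrow> \<gamma> \<noteq> {}"
proof -
  show "finite (perm_cycles V \<sigma>)"
    using assms by (simp add: perm_cycles_eq)
  have "finite (\<Union>(perm_cycles V \<sigma>))"
    using assms by (simp add: Union_perm_cycles)
  then show "finite \<gamma>" if "\<gamma> \<in> perm_cycles V \<sigma>"
    using that by (meson Union_upper finite_subset)
  show "\<gamma> \<noteq> {}" if "\<gamma> \<in> perm_cycles V \<sigma>"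
    using that assms by (auto simp: perm_cycles_eq orbit_pairs_def)
qed

text \<open>Arcs of a permutation already have in-degree and out-degree at most one, so only
  acyclicity is at stake. A closed path in \<open>F\<close> has to follow \<open>\<sigma>\<close>
  and so runs through a whole cycle.\<close>

lemma linear_arcs_perm_iff:
  assumes "finite V" "\<sigma> permutes V" "F \<subseteq> {(x, \<sigma> x) | x. x \<in> V}"
  shows "linear_arcs F \<longleftrightarrow> (\<forall>\<gamma>\<in>perm_cycles V \<sigma>. \<not> \<gamma> \<subseteq> F)"
proof
  assume lin: "linear_arcs F"
  show "\<forall>\<gamma>\<in>perm_cycles V \<sigma>. \<not> \<gamma> \<subseteq> F"
  proof (intro ballI notI)
    fix \<gamma> assume \<gamma>: "\<gamma> \<in> perm_cycles V \<sigma>" "\<gamma> \<subseteq> F"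
    then obtain x where x: "\<gamma> = orbit_pairs \<sigma> x"
      using assms by (auto simp: perm_cycles_eq)
    have arc: "((\<sigma> ^^ n) x, (\<sigma> ^^ Suc n) x) \<in> F" for n
      using \<gamma>(2) unfolding x orbit_pairs_def by blast
    have path: "(x, (\<sigma> ^^ Suc n) x) \<in> F\<^sup>+" for n
    proof (induction n)
      case 0
      then show ?case using arc[of 0] by auto
    next
      case (Suc n)
      then show ?case using arc[of "Suc n"] by (rule trancl_into_trancl)
    qed
    have "permutation \<sigma>"
      using assms permutation_permutes by blast
    then obtain k where "(\<sigma> ^^ k) x = x" "k > 0"
      using least_power_of_permutation by metis
    then have "(x, x) \<in> F\<^sup>+"
      using path[of "k - 1"] by simp
    then show False
      using lin by (auto simp: linear_arcs_def acyclic_def)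
  qed
next
  assume no_cycle: "\<forall>\<gamma>\<in>perm_cycles V \<sigma>. \<not> \<gamma> \<subseteq> F"
  have "acyclic F"
    unfolding acyclic_def
  proof (intro allI notI)
    fix x assume x: "(x, x) \<in> F\<^sup>+"
    \<comment> \<open>The only arc that can leave \<open>y\<close> goes to
      \<open>\<sigma> y\<close>. If this is already \<open>x\<close>, the closed path at
      \<open>x\<close> supplies a nonempty path.\<close>
    have step: "(y, \<sigma> y) \<in> F \<and> (\<sigma> y, x) \<in> F\<^sup>+" if y: "(y, x) \<in> F\<^sup>+" for y
    proof -
      obtain z where z: "(y, z) \<in> F" "(z, x) \<in> F\<^sup>*"
        using y by (meson tranclD)
      then have "z = \<sigma> y"
        using assms(3) by auto
      then show ?thesis
        using z x by (metis rtrancl_trancl_trancl)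
    qed
    have return: "((\<sigma> ^^ n) x, x) \<in> F\<^sup>+" for n
      by (induction n) (use x step in auto)
    have "orbit_pairs \<sigma> x \<subseteq> F"
      using step[OF return] by (auto simp: orbit_pairs_def)
    moreover have "x \<in> V"
      using tranclD[OF x] assms(3) by auto
    ultimately show False
      using no_cycle assms by (auto simp: perm_cycles_eq)
  qed
  moreover have "single_valued F" "single_valued (F\<inverse>)"
    using assms(3) permutes_inj[OF assms(2)] by (auto simp: single_valued_def dest: injD)
  ultimately show "linear_arcs F"
    by (simp add: linear_arcs_def)
qed


section \<open>Friendly listings and compatible permutations\<close>

text \<open>
  A cycle in the complement contributes the alternating sum over all subsets of its arcs lying
  in the digraph, and the sign of a cycle in the digraph cancels the term of the full cycle.
\<close>

lemma sum_compatible_perms: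
  assumes "finite (pverts X)" "\<sigma> permutes pverts X"
  shows "(if \<sigma> \<in> compatible_perms X then (-1) ^ perm_phi X \<sigma> else 0) =
    (\<Sum>F | F \<subseteq> {(x, \<sigma> x) | x. x \<in> pverts X} \<inter> parcs X \<and> linear_arcs F. (-1::int) ^ card F)"
proof -
  let ?C = "perm_cycles (pverts X) \<sigma>" and ?E = "parcs X"
  let ?g = "\<lambda>\<gamma>. if \<gamma> \<subseteq> ?E then (-1::int) ^ (card \<gamma> - 1) else of_bool (\<gamma> \<inter> ?E = {})"
  note C = perm_cycles_finite[OF assms]
  \<comment> \<open>The arcs of a cycle join vertices, so lying in the complement means avoiding
    \<open>?E\<close>.\<close>
  have compl: "is_digraph_cycle (complement_digraph X) \<gamma> \<longleftrightarrow> \<gamma> \<inter> ?E = {}" if "\<gamma> \<in> ?C" for \<gamma>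
  proof -
    have "\<gamma> \<subseteq> \<Union>?C"
      using that by auto
    also have "\<dots> \<subseteq> pverts X \<times> pverts X"
      unfolding Union_perm_cycles[OF assms] using permutes_in_image[OF assms(2)] by auto
    finally show ?thesis
      by (auto simp: is_digraph_cycle_def complement_digraph_def)
  qed
  have "(\<Sum>F | F \<subseteq> {(x, \<sigma> x) | x. x \<in> pverts X} \<inter> ?E \<and> linear_arcs F. (-1::int) ^ card F) =
    (\<Sum>F | F \<subseteq> \<Union>?C \<inter> ?E \<and> (\<forall>\<gamma>\<in>?C. \<not> \<gamma> \<subseteq> F). (-1) ^ card F)"
    unfolding Union_perm_cycles[OF assms]
    using linear_arcs_perm_iff[OF assms] by (intro sum.cong) auto
  also have "\<dots> = (\<Prod>\<gamma>\<in>?C. \<Sum>S | S \<subseteq> \<gamma> \<inter> ?E \<and> \<not> \<gamma> \<subseteq> S. (-1) ^ card S)"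
    using C(1,2) pairwise_disjnt_perm_cycles[OF assms]
    by (intro prod_alternating_sum_disjoint[symmetric]) auto
  also have "\<dots> = (\<Prod>\<gamma>\<in>?C. ?g \<gamma>)"
    using C by (intro prod.cong alternating_sum_proper_subsets) auto
  also have "\<dots> = (if \<sigma> \<in> compatible_perms X then (-1) ^ perm_phi X \<sigma> else 0)"
  proof (cases "\<sigma> \<in> compatible_perms X")
    case True
    then have compat: "\<gamma> \<subseteq> ?E \<or> \<gamma> \<inter> ?E = {}" if "\<gamma> \<in> ?C" for \<gamma>
      using that compl by (auto simp: compatible_perms_def is_digraph_cycle_def)
    \<comment> \<open>Cycles of the complement contribute the factor 1; the others give the exponent
      \<open>perm_phi\<close>.\<close>
    have "(\<Prod>\<gamma>\<in>?C. ?g \<gamma>) = (\<Prod>\<gamma>\<in>?C. if \<gamma> \<subseteq> ?E then (-1) ^ (card \<gamma> - 1) else 1)"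
      using compat by (intro prod.cong) auto
    also have "\<dots> = (-1) ^ perm_phi X \<sigma>"
      unfolding perm_phi_def is_digraph_cycle_def power_sum
      using C(1) by (rule prod.inter_filter[symmetric])
    finally show ?thesis
      using True by simp
  next
    case False
    \<comment> \<open>A cycle with arcs both in and outside the digraph makes the product
      vanish.\<close>
    then obtain \<gamma> where "\<gamma> \<in> ?C" "\<not> \<gamma> \<subseteq> ?E" "\<gamma> \<inter> ?E \<noteq> {}"
      using assms(2) compl by (auto simp: compatible_perms_def is_digraph_cycle_def)
    then show ?thesis
      using C(1) False by (auto intro!: prod_zero bexI[of _ \<gamma>])
  qed
  finally show ?thesis ..
qed

section \<open>Inclusion-exclusion for a fixed coloring\<close>

text \<open>Along a sorted listing strict increase can fail only by equality, so just the
  monochromatic arcs are forbidden.\<close>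

lemma friendly_listings_eq:
  "friendly_listings f X = {s \<in> sorted_listings f (pverts X).
     consecutive_pairs s \<inter> (parcs X \<inter> {(x, y). f x = f y}) = {}}"
proof -
  have "(\<forall>j. Suc j < length s \<longrightarrow> (s ! j, s ! Suc j) \<in> parcs X \<longrightarrow> f (s ! j) < f (s ! Suc j)) \<longleftrightarrow>
    consecutive_pairs s \<inter> (parcs X \<inter> {(x, y). f x = f y}) = {}" if "sorted (map f s)" for s
  proof -
    have "f (s ! j) \<le> f (s ! Suc j)" if "Suc j < length s" for j
      using sorted_nth_mono[OF \<open>sorted (map f s)\<close>, of j "Suc j"] that by simp
    then show ?thesis
      by (auto simp: consecutive_pairs_def order_less_le)
  qed
  then show ?thesis
    by (auto simp: friendly_listings_def sorted_listings_def)
qed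

lemma sum_sum_subsets:
  assumes "finite A" "finite E"
  shows "(\<Sum>s\<in>A. \<Sum>F | F \<subseteq> E \<and> P s F. (-1::int) ^ card F) =
    (\<Sum>F\<in>Pow E. int (card {s \<in> A. P s F}) * (-1) ^ card F)"
proof -
  have "(\<Sum>s\<in>A. \<Sum>F | F \<subseteq> E \<and> P s F. (-1::int) ^ card F) =
    (\<Sum>s\<in>A. \<Sum>F\<in>Pow E. if P s F then (-1) ^ card F else 0)"
    using assms(2) by (simp only: Pow_def sum.inter_filter[symmetric] finite_Collect_subsets) simp
  also have "\<dots> = (\<Sum>F\<in>Pow E. \<Sum>s\<in>A. if P s F then (-1) ^ card F else 0)"
    by (rule sum.swap)
  also have "\<dots> = (\<Sum>F\<in>Pow E. int (card {s \<in> A. P s F}) * (-1) ^ card F)"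
    using assms(1) by (intro sum.cong refl) (simp add: sum.inter_filter[symmetric])
  finally show ?thesis .
qed

lemma card_friendly_listings:
  assumes "finite (pverts X)" "parcs X \<subseteq> pverts X \<times> pverts X"
  shows "int (card (friendly_listings f X)) =
    (\<Sum>\<sigma> | \<sigma> \<in> compatible_perms X \<and> (\<forall>x\<in>pverts X. f (\<sigma> x) = f x). (-1) ^ perm_phi X \<sigma>)"
proof -
  let ?V = "pverts X" and ?E = "parcs X \<inter> {(x, y). f x = f y}"
  let ?graph = "\<lambda>\<sigma>. {(x, \<sigma> x) | x. x \<in> ?V}"
  have fin: "finite ?E"
    using assms by (meson finite_Int finite_SigmaI finite_subset)
  have "int (card (friendly_listings f X)) =
    (\<Sum>s\<in>sorted_listings f ?V. of_bool (consecutive_pairs s \<inter> ?E = {}))"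
    by (simp add: friendly_listings_eq of_bool_def sum.If_cases Collect_conj_eq)
  \<comment> \<open>Inclusion-exclusion: the indicator of an empty intersection is the alternating
    sum over its subsets.\<close>
  also have "\<dots> = (\<Sum>s\<in>sorted_listings f ?V.
      \<Sum>F | F \<subseteq> ?E \<and> F \<subseteq> consecutive_pairs s. (-1) ^ card F)"
  proof (intro sum.cong refl)
    fix s
    have "{F. F \<subseteq> ?E \<and> F \<subseteq> consecutive_pairs s} = Pow (consecutive_pairs s \<inter> ?E)"
      by auto
    then show "of_bool (consecutive_pairs s \<inter> ?E = {}) =
        (\<Sum>F | F \<subseteq> ?E \<and> F \<subseteq> consecutive_pairs s. (-1::int) ^ card F)"
      using fin by (simp only: sum_alternating_Pow finite_Int simp_thms)
  qed
  also have "\<dots> = (\<Sum>F\<in>Pow ?E.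
      int (card {s \<in> sorted_listings f ?V. F \<subseteq> consecutive_pairs s}) * (-1) ^ card F)"
    using fin by (intro sum_sum_subsets) auto
  \<comment> \<open>Linearity has to be demanded on the side of permutations, whose graphs contain
    cycles; for listings it is automatic, so a nonlinear \<open>F\<close> counts zero on both
    sides.\<close>
  also have "\<dots> = (\<Sum>F\<in>Pow ?E.
      int (card {\<sigma> \<in> color_perms f ?V. F \<subseteq> ?graph \<sigma> \<and> linear_arcs F}) * (-1) ^ card F)"
  proof (intro sum.cong refl arg_cong2[where f = "(*)"] arg_cong[where f = int])
    fix F assume F: "F \<in> Pow ?E"
    show "card {s \<in> sorted_listings f ?V. F \<subseteq> consecutive_pairs s} =
      card {\<sigma> \<in> color_perms f ?V. F \<subseteq> ?graph \<sigma> \<and> linear_arcs F}"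
    proof (cases "linear_arcs F")
      case True
      have FV: "F \<subseteq> ?V \<times> ?V"
        using F assms(2) by blast
      have color: "f x = f y" if "(x, y) \<in> F" for x y
        using that F by auto
      have "F \<subseteq> ?graph \<sigma> \<longleftrightarrow> (\<forall>(x, y)\<in>F. \<sigma> x = y)" for \<sigma>
        using FV by fastforce
      then show ?thesis
        using card_listings_eq_card_perms[OF assms(1) True FV color] True by simp
    next
      case False
      then have "{s \<in> sorted_listings f ?V. F \<subseteq> consecutive_pairs s} = {}"
        by (auto simp: sorted_listings_iff dest: linear_consecutive_pairs linear_arcs_mono)
      with False show ?thesis
        by simp
    qed
  qed
  also have "\<dots> = (\<Sum>\<sigma>\<in>color_perms f ?V.
      \<Sum>F | F \<subseteq> ?E \<and> F \<subseteq> ?graph \<sigma> \<and> linear_arcs F. (-1) ^ card F)"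
    using fin assms(1) by (intro sum_sum_subsets[symmetric] finite_color_perms)
  also have "\<dots> = (\<Sum>\<sigma>\<in>color_perms f ?V.
      if \<sigma> \<in> compatible_perms X then (-1) ^ perm_phi X \<sigma> else 0)"
  proof (intro sum.cong refl)
    fix \<sigma> assume "\<sigma> \<in> color_perms f ?V"
    then have \<sigma>: "\<sigma> permutes ?V" "\<And>x. x \<in> ?V \<Longrightarrow> f (\<sigma> x) = f x"
      by (auto simp: color_perms_def)
    \<comment> \<open>Every arc of a color-preserving permutation is monochromatic, so
      \<open>?E\<close> may be replaced by \<open>parcs X\<close>.\<close>
    have "{F. F \<subseteq> ?E \<and> F \<subseteq> ?graph \<sigma> \<and> linear_arcs F} =
      {F. F \<subseteq> ?graph \<sigma> \<inter> parcs X \<and> linear_arcs F}"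
      using \<sigma>(2) by fastforce
    then show "(\<Sum>F | F \<subseteq> ?E \<and> F \<subseteq> ?graph \<sigma> \<and> linear_arcs F. (-1) ^ card F) =
      (if \<sigma> \<in> compatible_perms X then (-1::int) ^ perm_phi X \<sigma> else 0)"
      using sum_compatible_perms[OF assms(1) \<sigma>(1)] by simp
  qed
  also have "\<dots> = (\<Sum>\<sigma> | \<sigma> \<in> color_perms f ?V \<and> \<sigma> \<in> compatible_perms X. (-1) ^ perm_phi X \<sigma>)"
    using assms(1) by (simp add: sum.inter_filter finite_color_perms)
  also have "\<dots> = (\<Sum>\<sigma> | \<sigma> \<in> compatible_perms X \<and> (\<forall>x\<in>?V. f (\<sigma> x) = f x). (-1) ^ perm_phi X \<sigma>)"
    by (intro sum.cong) (auto simp: color_perms_def compatible_perms_def)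
  finally show ?thesis .
qed

section \<open>From colorings to coefficients of words\<close>

text \<open>Blocks are the position sets of cycles, and a coloring is constant on each cycle exactly
  when one step of \<open>\<sigma>\<close> preserves it. Thus the coefficient of a power sum selects
  the color-preserving permutations.\<close>

lemma constant_on_perm_type_iff:
  assumes "distinct vs" "\<sigma> permutes set vs"
  shows "(\<forall>B\<in>perm_type vs \<sigma>. \<forall>j\<in>B. \<forall>k\<in>B. map f vs ! j = map f vs ! k) \<longleftrightarrow>
    (\<forall>x\<in>set vs. f (\<sigma> x) = f x)"
proof
  note cycles = perm_cycles_eq[OF finite_set assms(2)]
  assume const: "\<forall>B\<in>perm_type vs \<sigma>. \<forall>j\<in>B. \<forall>k\<in>B. map f vs ! j = map f vs ! k"
  show "\<forall>x\<in>set vs. f (\<sigma> x) = f x"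
  proof
    fix x assume x: "x \<in> set vs"
    let ?B = "{i. i < length vs \<and> vs ! i \<in> Domain (orbit_pairs \<sigma> x)}"
    have B: "?B \<in> perm_type vs \<sigma>"
      using x by (auto simp: perm_type_def cycles)
    have "\<sigma> x \<in> set vs"
      using x permutes_in_image[OF assms(2)] by simp
    then obtain j k where jk: "j < length vs" "vs ! j = \<sigma> x" "k < length vs" "vs ! k = x"
      using x by (meson in_set_conv_nth)
    have "((\<sigma> ^^ n) x) \<in> Domain (orbit_pairs \<sigma> x)" for n
      by (auto simp: orbit_pairs_def)
    \<comment> \<open>The iterates 0 and 1 place \<open>x\<close> and \<open>\<sigma> x\<close> on
      the same cycle.\<close>
    from this[of 0] this[of 1] have "j \<in> ?B" "k \<in> ?B"
      using jk by auto
    then have "map f vs ! j = map f vs ! k"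
      by (rule bspec[OF bspec[OF bspec[OF const B]]])
    then show "f (\<sigma> x) = f x"
      using jk by simp
  qed
next
  note cycles = perm_cycles_eq[OF finite_set assms(2)]
  assume const: "\<forall>x\<in>set vs. f (\<sigma> x) = f x"
  show "\<forall>B\<in>perm_type vs \<sigma>. \<forall>j\<in>B. \<forall>k\<in>B. map f vs ! j = map f vs ! k"
  proof (intro ballI)
    fix B j k assume B: "B \<in> perm_type vs \<sigma>" and jk: "j \<in> B" "k \<in> B"
    from B obtain x where x: "x \<in> set vs"
      "B = {i. i < length vs \<and> vs ! i \<in> Domain (orbit_pairs \<sigma> x)}"
      by (auto simp: perm_type_def cycles)
    have pow: "(\<sigma> ^^ n) x \<in> set vs \<and> f ((\<sigma> ^^ n) x) = f x" for n
      by (induction n) (use x const permutes_in_image[OF assms(2)] in auto)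
    have "map f vs ! i = f x" if "i \<in> B" for i
      using that pow unfolding x(2) by (auto simp: orbit_pairs_def)
    then show "map f vs ! j = map f vs ! k"
      using jk by simp
  qed
qed

theorem theorem3p10:
  fixes X :: "'a pair_pre_digraph" and vs :: "'a list"
  assumes "pair_fin_digraph X"
    and "distinct vs" and "set vs = pverts X"
  shows "redei_berge X vs =
    (\<lambda>w. \<Sum>\<sigma> \<in> compatible_perms X.
       (-1) ^ perm_phi X \<sigma> * nc_power_sum (length vs) (perm_type vs \<sigma>) w)"
proof
  fix w :: "nat list"
  interpret pair_fin_digraph X by fact
  have arcs: "parcs X \<subseteq> pverts X \<times> pverts X"
    by (auto dest: in_arcsD1 in_arcsD2)
  have fin: "finite (compatible_perms X)"
    using finite_permutations[OF pair_finite_verts]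
    by (rule finite_subset[rotated]) (auto simp: compatible_perms_def)
  let ?const = "\<lambda>\<sigma>. \<forall>B\<in>perm_type vs \<sigma>. \<forall>j\<in>B. \<forall>k\<in>B. w ! j = w ! k"
  \<comment> \<open>Each admissible word is its own monomial, so the coefficient is an
    indicator.\<close>
  have power_sum: "nc_power_sum (length vs) \<pi> w = of_bool (length w = length vs \<and>
      set w \<subseteq> {1..} \<and> (\<forall>B\<in>\<pi>. \<forall>j\<in>B. \<forall>k\<in>B. w ! j = w ! k))" for \<pi>
  proof -
    have single: "(\<Sum>v\<in>{v \<in> S. v = w}. 1::int) = of_bool (w \<in> S)" for S
    proof -
      have "{v \<in> S. v = w} = (if w \<in> S then {w} else {})"
        by auto
      then show ?thesis
        by simp
    qed
    then show ?thesis
      unfolding nc_power_sum_def nc_sum_def by (subst single) simp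
  qed
  show "redei_berge X vs w = (\<Sum>\<sigma> \<in> compatible_perms X.
       (-1) ^ perm_phi X \<sigma> * nc_power_sum (length vs) (perm_type vs \<sigma>) w)"
  proof (cases "length w = length vs \<and> set w \<subseteq> {1..}")
    case False
    \<comment> \<open>Such a word comes from no coloring, and no power sum contains it: both sides
      are 0.\<close>
    have empty: "{f \<in> pverts X \<rightarrow>\<^sub>E {1..}. map f vs = w} = {}"
      using False assms(3) by auto
    have zero: "of_bool (length w = length vs \<and> set w \<subseteq> {1..} \<and> P) = (0::int)" for P
      using False by auto
    show ?thesis
      unfolding redei_berge_def nc_sum_def power_sum empty zero by simp
  next
    case True
    \<comment> \<open>The coloring read off from \<open>w\<close>, restricted to the vertices as
      \<open>\<rightarrow>\<^sub>E\<close> requires. It is the only one with this word, so the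
      formal sum has a single term.\<close>
    define f where "f = restrict (\<lambda>x. the (map_of (zip vs w) x)) (pverts X)"
    have nth: "f (vs ! i) = w ! i" if "i < length vs" for i
      using that True assms(2,3) by (auto simp: f_def map_of_zip_nth)
    have w: "map f vs = w"
      using True nth by (auto intro: nth_equalityI)
    have f: "f \<in> pverts X \<rightarrow>\<^sub>E {1..}"
    proof (rule PiE_I)
      show "f x \<in> {1..}" if "x \<in> pverts X" for x
        using that True w assms(3) by (metis image_eqI list.set_map subsetD)
    qed (simp add: f_def)
    have "g = f" if "g \<in> pverts X \<rightarrow>\<^sub>E {1..}" "map g vs = w" for g
      using inj_on_coloring_word[of vs "{1..}"] that f w unfolding assms(3)
      by (metis (mono_tags, lifting) inj_onD)
    with f w have "{g \<in> pverts X \<rightarrow>\<^sub>E {1..}. map g vs = w} = {f}"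
      by blast
    then have "redei_berge X vs w = int (card (friendly_listings f X))"
      by (simp add: redei_berge_def nc_sum_def)
    also have "\<dots> = (\<Sum>\<sigma> | \<sigma> \<in> compatible_perms X \<and> (\<forall>x\<in>pverts X. f (\<sigma> x) = f x).
        (-1) ^ perm_phi X \<sigma>)"
      by (rule card_friendly_listings[OF pair_finite_verts arcs])
    also have "\<dots> = (\<Sum>\<sigma>\<in>compatible_perms X.
        if \<forall>x\<in>pverts X. f (\<sigma> x) = f x then (-1) ^ perm_phi X \<sigma> else 0)"
      using fin by (rule sum.inter_filter)
    also have "\<dots> = (\<Sum>\<sigma> \<in> compatible_perms X.
       (-1) ^ perm_phi X \<sigma> * nc_power_sum (length vs) (perm_type vs \<sigma>) w)"
    proof (intro sum.cong refl)
      fix \<sigma> assume "\<sigma> \<in> compatible_perms X"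
      then have "\<sigma> permutes set vs"
        using assms(3) by (simp add: compatible_perms_def)
      then have "?const \<sigma> \<longleftrightarrow> (\<forall>x\<in>pverts X. f (\<sigma> x) = f x)"
        using constant_on_perm_type_iff[OF assms(2), of \<sigma> f] w assms(3) by simp
      then show "(if \<forall>x\<in>pverts X. f (\<sigma> x) = f x then (-1) ^ perm_phi X \<sigma> else 0) =
          (-1) ^ perm_phi X \<sigma> * nc_power_sum (length vs) (perm_type vs \<sigma>) w"
        unfolding power_sum using True by simp
    qed
    finally show ?thesis .
  qed
qed

end
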